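(* Let $c>0$ and $\delta\neq0$ be real constants and let $F$ be the distribution function of a non-degenerate integrable real random variable, with $G=1-F$. With $H$, $S$ and $T$ as defined in the context, consider the statements: (a) $F\in\mathbf{P}_{c,\delta}$. (b) $F(S)=1$. (c) $H(x)=0$ for all $x\in T$. (d) $G(x+\delta)-G(y+\delta)=c\int_x^y G(t)\,dt$ for all $x,y\in T$. Then the following assertions hold: (i) (a), (b) and (c) are equivalent and imply (d). (ii) If $\delta>0$ then (d) implies (c). (iii) If $\delta<0$ and $\omega_F=\infty$ then (d) implies (c).
   Context: Let $(X_n)_{n\ge1}$ be independent, identically distributed, integrable real random variables with non-degenerate distribution function $F$, and let $G=1-F$. Put $\mathcal{F}_n=\sigma(X_1,\ldots,X_n)$ and $M_n=\max\{X_1,\ldots,X_n\}$. For a real $\delta\neq0$ let $I_1=1$ and, for $n\ge2$, let $I_n=1$ if $X_n>M_{n-1}+\delta$ and $I_n=0$ otherwise; let $N_n=\sum_{k=1}^n I_k$ (the number of $\delta$-records among the first $n$ observations). For real $c>0$ and $\delta\ne0$, write $F\in\mathbf{P}_{c,\delta}$ if $F$ is such a (non-degenerate, finite-mean) distribution function and $(N_n-cM_n)_{n\ge1}$ is an $(\mathcal{F}_n)$-martingale. For a Borel set $A\subseteq\mathbb{R}$, $F(A)=\int_A F(dx)$ denotes the probability that $F$ assigns to $A$. The support is $\mathrm{supp}(F)=\{x\in\mathbb{R}:F(x+\epsilon)-F(x-\epsilon)>0\ \forall\epsilon>0\}$, and $\omega_F=\sup\mathrm{supp}(F)$ (possibly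 infinite). Define $$H(x)=G(x+\delta)-c\int_x^\infty G(t)\,dt,\quad x\in\mathbb{R},\qquad S=\{x\in\mathbb{R}:H(x)=0\},$$ $$R=\{x\in\mathrm{supp}(F):F(\{x\})=0,\ F(\{x+\delta\})>0\},\qquad T=\mathrm{supp}(F)\setminus R.$$ *)

theory Defs
  imports "HOL-Probability.Probability"
begin

subsection \<open>Distribution functions\<close>

text \<open>\<open>mass F A\<close> is \<open>F(A)\<close>, the probability that the distribution function \<open>F\<close> assigns to
  the Borel set \<open>A\<close>; the underlying Stieltjes measure is the law itself by
  \<open>interval_measure_cdf\<close> below.\<close>

definition mass :: "(real \<Rightarrow> real) \<Rightarrow> real set \<Rightarrow> real" where
  "mass F A = measure (interval_measure F) A"

definition nondegenerate :: "(real \<Rightarrow> real) \<Rightarrow> bool" where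
  "nondegenerate F \<longleftrightarrow> (\<forall>a. mass F {a} \<noteq> 1)"

definition tail :: "(real \<Rightarrow> real) \<Rightarrow> real \<Rightarrow> real" where
  "tail F x = 1 - F x"

definition supp :: "(real \<Rightarrow> real) \<Rightarrow> real set" where
  "supp F = {x. \<forall>\<epsilon>>0. F (x + \<epsilon>) - F (x - \<epsilon>) > 0}"

definition omega :: "(real \<Rightarrow> real) \<Rightarrow> ereal" where
  "omega F = Sup (ereal ` supp F)"

text \<open>For a finite-mean law the improper integral below is finite, so the default value 0 of a
  non-convergent Lebesgue integral does not occur.\<close>

definition H_fun :: "real \<Rightarrow> real \<Rightarrow> (real \<Rightarrow> real) \<Rightarrow> real \<Rightarrow> real" where
  "H_fun c \<delta> F x = tail F (x + \<delta>) - c * (LBINT t=ereal x..\<infinity>. tail F t)"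

definition S_set :: "real \<Rightarrow> real \<Rightarrow> (real \<Rightarrow> real) \<Rightarrow> real set" where
  "S_set c \<delta> F = {x. H_fun c \<delta> F x = 0}"

definition R_set :: "real \<Rightarrow> (real \<Rightarrow> real) \<Rightarrow> real set" where
  "R_set \<delta> F = {x \<in> supp F. mass F {x} = 0 \<and> mass F {x + \<delta>} > 0}"

definition T_set :: "real \<Rightarrow> (real \<Rightarrow> real) \<Rightarrow> real set" where
  "T_set \<delta> F = supp F - R_set \<delta> F"

subsection \<open>Samples and delta-records\<close>

text \<open>Sequences are indexed by the positive naturals; the value at index 0 is never used.\<close>

definition iid_sample :: "'a measure \<Rightarrow> (nat \<Rightarrow> 'a \<Rightarrow> real) \<Rightarrow> (real \<Rightarrow> real) \<Rightarrow> bool" where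
  "iid_sample M X F \<longleftrightarrow>
     prob_space M \<and>
     prob_space.indep_vars M (\<lambda>_. borel) X {1..} \<and>
     (\<forall>n\<ge>1. cdf (distr M borel (X n)) = F) \<and>
     (\<forall>n\<ge>1. integrable M (X n)) \<and>
     nondegenerate F"

definition nat_filtration :: "'a measure \<Rightarrow> (nat \<Rightarrow> 'a \<Rightarrow> real) \<Rightarrow> nat \<Rightarrow> 'a measure" where
  "nat_filtration M X n =
     sigma (space M) (\<Union>i\<in>{1..n}. {X i -` A \<inter> space M | A. A \<in> sets borel})"

definition partial_max :: "(nat \<Rightarrow> 'a \<Rightarrow> real) \<Rightarrow> nat \<Rightarrow> 'a \<Rightarrow> real" where
  "partial_max X n \<omega> = Max ((\<lambda>i. X i \<omega>) ` {1..n})"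

definition record_ind :: "real \<Rightarrow> (nat \<Rightarrow> 'a \<Rightarrow> real) \<Rightarrow> nat \<Rightarrow> 'a \<Rightarrow> real" where
  "record_ind \<delta> X n \<omega> =
     (if n = 1 then 1 else if X n \<omega> > partial_max X (n - 1) \<omega> + \<delta> then 1 else 0)"

definition num_records :: "real \<Rightarrow> (nat \<Rightarrow> 'a \<Rightarrow> real) \<Rightarrow> nat \<Rightarrow> 'a \<Rightarrow> real" where
  "num_records \<delta> X n \<omega> = (\<Sum>k = 1..n. record_ind \<delta> X k \<omega>)"

definition martingale ::
  "'a measure \<Rightarrow> (nat \<Rightarrow> 'a measure) \<Rightarrow> (nat \<Rightarrow> 'a \<Rightarrow> real) \<Rightarrow> bool" where
  "martingale M \<F> Z \<longleftrightarrow>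
     (\<forall>n\<ge>1. subalgebra M (\<F> n)) \<and>
     (\<forall>m\<ge>1. \<forall>n\<ge>m. subalgebra (\<F> n) (\<F> m)) \<and>
     (\<forall>n\<ge>1. Z n \<in> borel_measurable (\<F> n)) \<and>
     (\<forall>n\<ge>1. integrable M (Z n)) \<and>
     (\<forall>m\<ge>1. \<forall>n\<ge>m. AE \<omega> in M. real_cond_exp M (\<F> m) (Z n) \<omega> = Z m \<omega>)"

text \<open>The condition \<open>F \<in> P\<^bsub>c,\<delta>\<^esub>\<close>, expressed for a given i.i.d. sequence \<open>X\<close> on \<open>M\<close> with
  distribution function \<open>F\<close>. Such a sequence exists for every eligible \<open>F\<close>, see
  \<open>iid_sample_exists\<close> below.\<close>

definition in_P ::
  "'a measure \<Rightarrow> (nat \<Rightarrow> 'a \<Rightarrow> real) \<Rightarrow> real \<Rightarrow> real \<Rightarrow> (real \<Rightarrow> real) \<Rightarrow> bool" where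
  "in_P M X c \<delta> F \<longleftrightarrow>
     iid_sample M X F \<and>
     martingale M (nat_filtration M X) (\<lambda>n \<omega>. num_records \<delta> X n \<omega> - c * partial_max X n \<omega>)"

lemma interval_measure_cdf:
  assumes "real_distribution \<mu>"
  shows "interval_measure (cdf \<mu>) = \<mu>"
proof -
  interpret real_distribution \<mu> by fact
  have "real_distribution (interval_measure (cdf \<mu>))"
    by (intro real_distribution_interval_measure cdf_nondecreasing cdf_is_right_cont
        cdf_lim_at_bot cdf_lim_at_top_prob)
  moreover have "cdf (interval_measure (cdf \<mu>)) = cdf \<mu>"
    by (intro cdf_interval_measure cdf_nondecreasing cdf_is_right_cont cdf_lim_at_bot
        cdf_lim_at_top_prob)
  ultimately show ?thesis
    using assms by (intro cdf_unique)
qed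

lemma iid_sample_exists:
  assumes \<mu>: "real_distribution \<mu>" and int: "integrable \<mu> (\<lambda>x. x)"
    and nd: "nondegenerate (cdf \<mu>)"
  shows "iid_sample (\<Pi>\<^sub>M n\<in>(UNIV :: nat set). \<mu>) (\<lambda>n \<omega>. \<omega> n) (cdf \<mu>)"
proof -
  interpret real_distribution \<mu> by fact
  let ?M = "\<Pi>\<^sub>M n\<in>(UNIV :: nat set). \<mu>"
  interpret P: product_prob_space "\<lambda>_::nat. \<mu>" UNIV ..
  have sets: "sets \<mu> = sets borel" by simp
  have d: "distr ?M \<mu> (\<lambda>\<omega>. \<omega> n) = \<mu>" for n :: nat
    by (rule P.PiM_component) simp
  have db: "distr ?M borel (\<lambda>\<omega>. \<omega> n) = \<mu>" for n :: nat
    using d[of n] by (subst (asm) distr_cong[OF refl sets refl])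
  have meas: "(\<lambda>\<omega>. \<omega> n) \<in> ?M \<rightarrow>\<^sub>M \<mu>" for n :: nat
    by simp
  have measb: "(\<lambda>\<omega>. \<omega> n) \<in> ?M \<rightarrow>\<^sub>M borel" for n :: nat
    using meas[of n] by (simp add: measurable_cong_sets[OF refl sets])
  have "P.indep_vars (\<lambda>_. borel) (\<lambda>n \<omega>. \<omega> n) UNIV"
  proof (subst P.indep_vars_iff_distr_eq_PiM')
    have "distr ?M (Pi\<^sub>M UNIV (\<lambda>_. borel)) (\<lambda>x. \<lambda>i\<in>UNIV. x i) = distr ?M ?M (\<lambda>x. x)"
      by (intro distr_cong sets_PiM_cong) (auto simp: sets)
    then show "distr ?M (Pi\<^sub>M UNIV (\<lambda>_. borel)) (\<lambda>x. \<lambda>i\<in>UNIV. x i) =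
        Pi\<^sub>M UNIV (\<lambda>i. distr ?M borel (\<lambda>\<omega>. \<omega> i))"
      by (simp add: db)
  qed (use measb in auto)
  then have "P.indep_vars (\<lambda>_. borel) (\<lambda>n \<omega>. \<omega> n) {1..}"
    by (rule P.indep_vars_subset) simp
  moreover have "integrable ?M (\<lambda>\<omega>. \<omega> n)" for n :: nat
    by (rule integrable_distr[OF meas[of n]]) (unfold d, rule int)
  ultimately show ?thesis
    unfolding iid_sample_def using P.prob_space_axioms nd by (simp add: db)
qed

end

theory Submission
  imports Defs
begin

text \<open>
  Given the first \<open>n\<close> observations, the next increment of \<open>N\<^sub>n - c M\<^sub>n\<close> is
  \<open>1(X\<^sub>n\<^sub>+\<^sub>1 > M\<^sub>n + \<delta>) - c (X\<^sub>n\<^sub>+\<^sub>1 - M\<^sub>n)\<^sup>+\<close>.  Since \<open>X\<^sub>n\<^sub>+\<^sub>1\<close> is independent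
  of the past and \<open>E (X - m)\<^sup>+\<close> is the integral of \<open>G\<close> over \<open>(m, \<infinity>)\<close>,
  its conditional mean is \<open>H(M\<^sub>n)\<close> (\<open>cond_exp_Z_Suc\<close>).  So the martingale property says
  that \<open>H(M\<^sub>n) = 0\<close> almost surely for all \<open>n\<close>.  The case \<open>n = 1\<close> is
  \<open>H(X\<^sub>1) = 0\<close> almost surely, that is (b), and this case implies the others because
  \<open>M\<^sub>n\<close> is always one of the observations (\<open>in_P_iff\<close>).

  To pass from almost every point to every point of \<open>T\<close>, note that \<open>H\<close> is continuous
  wherever \<open>x + \<delta>\<close> is not an atom, and that an atom \<open>x\<close> itself is charged.  The
  points of the support with neither property form the set \<open>R\<close>, which is countable and contains
  no atoms, so that almost every point lies in \<open>T\<close> (\<open>AE_H_fun_zero_iff\<close>).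

  Finally, (d) says that \<open>H\<close> is constant on \<open>T\<close> (\<open>H_fun_diff\<close>), so it follows from (c),
  and the converse amounts to finding the constant.  If the support is unbounded above, so is
  \<open>T\<close>, and \<open>H\<close> tends to \<open>0\<close> at infinity.  If \<open>\<delta> > 0\<close> and the right
  endpoint \<open>\<omega>\<^sub>F\<close> is finite, then \<open>\<omega>\<^sub>F\<close> itself lies in \<open>T\<close> and
  \<open>H\<close> vanishes there.
\<close>

section \<open>The function \<open>H\<close> and the expected excess\<close>

text \<open>The stop-loss transform of a law, which is the integrated tail by Tonelli.\<close>

definition expected_excess :: "real measure \<Rightarrow> real \<Rightarrow> real" where
  "expected_excess \<mu> x = (\<integral>y. max 0 (y - x) \<partial>\<mu>)"

lemma mass_cdf: "real_distribution \<mu> \<Longrightarrow> mass (cdf \<mu>) A = measure \<mu> A"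
  by (simp add: mass_def interval_measure_cdf)

context real_distribution
begin

lemma tail_cdf: "tail (cdf M) x = prob {x<..}"
proof -
  have "prob (space M - {..x}) = 1 - prob {..x}"
    by (rule prob_compl) simp
  moreover have "space M - {..x} = {x<..}" by auto
  ultimately show ?thesis by (simp add: tail_def cdf_def)
qed

lemma tail_cdf_measurable [measurable]: "tail (cdf M) \<in> borel_measurable borel"
proof -
  have "cdf M \<in> borel_measurable borel"
    by (rule borel_measurable_mono) (simp add: mono_def cdf_nondecreasing)
  then show ?thesis by (simp add: tail_def[abs_def])
qed

lemma integrable_excess:
  assumes "integrable M (\<lambda>y. y)"
  shows "integrable M (\<lambda>y. max 0 (y - x))"
  using assms by (intro integrable_max) auto

text \<open>Write \<open>(y - x)\<^sup>+\<close> as the length of the interval \<open>(x, y)\<close>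
  and exchange the order of integration: the section at a fixed \<open>t > x\<close> is the event
  \<open>t < y\<close>, whose probability is the tail at \<open>t\<close>.\<close>

lemma nn_integral_excess:
  "(\<integral>\<^sup>+y. ennreal (max 0 (y - x)) \<partial>M)
    = (\<integral>\<^sup>+t. ennreal (indicator {x<..} t * tail (cdf M) t) \<partial>lborel)"
proof -
  interpret pair_sigma_finite M lborel ..
  let ?g = "\<lambda>y t. if x < t \<and> t < y then 1 else (0::ennreal)"
  have "ennreal (max 0 (y - x)) = (\<integral>\<^sup>+t. ?g y t \<partial>lborel)" for y
  proof -
    have "(\<integral>\<^sup>+t. ?g y t \<partial>lborel) = (\<integral>\<^sup>+t. indicator {x<..<y} t \<partial>lborel)"
      by (intro nn_integral_cong) (auto split: split_indicator)
    also have "\<dots> = ennreal (max 0 (y - x))"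
      by (cases "x \<le> y") (auto simp: max_def)
    finally show ?thesis by simp
  qed
  then have "(\<integral>\<^sup>+y. ennreal (max 0 (y - x)) \<partial>M) = (\<integral>\<^sup>+y. \<integral>\<^sup>+t. ?g y t \<partial>lborel \<partial>M)"
    by simp
  also have "\<dots> = (\<integral>\<^sup>+t. \<integral>\<^sup>+y. ?g y t \<partial>M \<partial>lborel)"
    by (rule Fubini'[symmetric]) measurable
  also have "\<dots> = (\<integral>\<^sup>+t. ennreal (indicator {x<..} t * tail (cdf M) t) \<partial>lborel)"
  proof (rule nn_integral_cong)
    fix t
    have "(\<integral>\<^sup>+y. ?g y t \<partial>M) = (\<integral>\<^sup>+y. indicator {x<..} t * indicator {t<..} y \<partial>M)"
      by (intro nn_integral_cong) (auto split: split_indicator)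
    also have "\<dots> = indicator {x<..} t * emeasure M {t<..}"
      by (simp add: nn_integral_cmult)
    finally show "(\<integral>\<^sup>+y. ?g y t \<partial>M) = ennreal (indicator {x<..} t * tail (cdf M) t)"
      by (auto simp: tail_cdf emeasure_eq_measure split: split_indicator)
  qed
  finally show ?thesis .
qed

lemma
  assumes "integrable M (\<lambda>y. y)"
  shows set_integrable_tail: "set_integrable lborel {x<..} (tail (cdf M))"
    and expected_excess_eq_tail_integral:
      "expected_excess M x = (LBINT t=ereal x..\<infinity>. tail (cdf M) t)"
proof -
  have "(\<integral>\<^sup>+y. ennreal (max 0 (y - x)) \<partial>M) = ennreal (expected_excess M x)"
    unfolding expected_excess_def
    by (intro nn_integral_eq_integral integrable_excess assms) auto
  moreover have "0 \<le> expected_excess M x"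
    unfolding expected_excess_def by (intro integral_nonneg_AE) auto
  ultimately have "has_bochner_integral lborel (\<lambda>t. indicator {x<..} t * tail (cdf M) t) (expected_excess M x)"
    unfolding nn_integral_excess
    by (intro has_bochner_integral_nn_integral AE_I2) (measurable, auto simp: tail_cdf)
  then show "set_integrable lborel {x<..} (tail (cdf M))"
    and "expected_excess M x = (LBINT t=ereal x..\<infinity>. tail (cdf M) t)"
    by (auto simp: set_integrable_def interval_integral_to_infinity_eq set_lebesgue_integral_def
        has_bochner_integral_iff)
qed

text \<open>This form of \<open>H\<close> avoids the improper integral: regularity and the behaviour
  at infinity are read off from the expectation.\<close>

lemma H_fun_cdf:
  assumes "integrable M (\<lambda>y. y)"
  shows "H_fun c \<delta> (cdf M) x = tail (cdf M) (x + \<delta>) - c * expected_excess M x"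
  by (simp add: H_fun_def expected_excess_eq_tail_integral[OF assms])

text \<open>Each \<open>x \<mapsto> (y - x)\<^sup>+\<close> is 1-Lipschitz, hence so is the average
  over \<open>y\<close>.\<close>

lemma continuous_expected_excess:
  assumes "integrable M (\<lambda>y. y)"
  shows "isCont (expected_excess M) x"
proof -
  have "1-lipschitz_on UNIV (expected_excess M)"
  proof (rule lipschitz_onI)
    fix x y
    have "\<bar>expected_excess M x - expected_excess M y\<bar>
        = \<bar>\<integral>z. max 0 (z - x) - max 0 (z - y) \<partial>M\<bar>"
      by (simp add: expected_excess_def integrable_excess[OF assms])
    also have "\<dots> \<le> (\<integral>z. \<bar>max 0 (z - x) - max 0 (z - y)\<bar> \<partial>M)"
      by (rule integral_abs_bound)
    also have "\<dots> \<le> (\<integral>z. \<bar>x - y\<bar> \<partial>M)"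
      by (intro integral_mono integrable_abs Bochner_Integration.integrable_diff
          integrable_excess assms) auto
    finally show "dist (expected_excess M x) (expected_excess M y) \<le> 1 * dist x y"
      using prob_space by (simp add: dist_real_def)
  qed simp
  then show ?thesis
    using lipschitz_on_continuous_on continuous_on_eq_continuous_at by blast
qed

lemma H_fun_measurable:
  assumes "integrable M (\<lambda>y. y)"
  shows "H_fun c \<delta> (cdf M) \<in> borel_measurable borel"
proof -
  have [measurable]: "expected_excess M \<in> borel_measurable borel"
    by (intro borel_measurable_continuous_onI continuous_at_imp_continuous_on ballI
        continuous_expected_excess assms)
  show ?thesis
    by (subst measurable_cong[OF H_fun_cdf[OF assms]]) measurable
qed

text \<open>The expected excess is always continuous, so a jump of \<open>H\<close> can only come from
  an atom at \<open>x + \<delta>\<close>.  This is why the set \<open>R\<close> is removed from the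
  support.\<close>

lemma isCont_H_fun:
  assumes "integrable M (\<lambda>y. y)" and "prob {x + \<delta>} = 0"
  shows "isCont (H_fun c \<delta> (cdf M)) x"
proof -
  have "isCont (cdf M) (x + \<delta>)" using assms(2) by (simp add: isCont_cdf)
  then have "isCont (\<lambda>x. cdf M (x + \<delta>)) x"
    by (rule isCont_o2[rotated]) simp
  then have "isCont (\<lambda>x. tail (cdf M) (x + \<delta>) - c * expected_excess M x) x"
    unfolding tail_def by (intro continuous_intros continuous_expected_excess assms)
  then show ?thesis by (simp add: H_fun_cdf[OF assms(1), abs_def])
qed

lemma filterlim_at_top_add_const: "filterlim (\<lambda>x. x + \<delta>) at_top (at_top :: real filter)"
  using filterlim_tendsto_add_at_top[OF tendsto_const[of \<delta>] filterlim_ident]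
  by (simp add: add.commute)

lemma H_fun_tendsto_0:
  assumes "integrable M (\<lambda>y. y)"
  shows "(H_fun c \<delta> (cdf M) \<longlongrightarrow> 0) at_top"
proof -
  have "(expected_excess M \<longlongrightarrow> (\<integral>y. 0 \<partial>M)) at_top"
    unfolding expected_excess_def[abs_def]
  proof (rule integral_dominated_convergence_at_top)
    show "\<forall>\<^sub>F x in at_top. AE y in M. norm (max 0 (y - x)) \<le> \<bar>y\<bar>"
      using eventually_ge_at_top[of "0::real"] by (rule eventually_mono) auto
    show "AE y in M. ((\<lambda>x. max 0 (y - x)) \<longlongrightarrow> 0) at_top"
    proof (rule AE_I2)
      fix y :: real
      have "\<forall>\<^sub>F x in at_top. max 0 (y - x) = 0"
        using eventually_ge_at_top[of y] by (rule eventually_mono) simp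
      then show "((\<lambda>x. max 0 (y - x)) \<longlongrightarrow> 0) at_top"
        by (rule tendsto_eventually)
    qed
    show "integrable M (\<lambda>y. \<bar>y\<bar>)" using assms by (rule integrable_abs)
  qed simp_all
  moreover have "((\<lambda>x. tail (cdf M) (x + \<delta>)) \<longlongrightarrow> 1 - 1) at_top"
    unfolding tail_def
    by (rule tendsto_diff[OF tendsto_const
          filterlim_compose[OF cdf_lim_at_top_prob filterlim_at_top_add_const]])
  ultimately have "((\<lambda>x. tail (cdf M) (x + \<delta>) - c * expected_excess M x) \<longlongrightarrow> (1 - 1) - c * 0) at_top"
    by (intro tendsto_diff tendsto_mult tendsto_const) auto
  then show ?thesis by (simp add: H_fun_cdf[OF assms, abs_def])
qed

text \<open>The integrals over \<open>(x, \<infinity>)\<close> and \<open>(y, \<infinity>)\<close> differ by the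
  signed integral from \<open>x\<close> to \<open>y\<close>, so assertion (d) says exactly that \<open>H\<close>
  is constant on \<open>T\<close>.\<close>

lemma H_fun_diff:
  assumes "integrable M (\<lambda>y. y)"
  shows "H_fun c \<delta> (cdf M) x - H_fun c \<delta> (cdf M) y
    = tail (cdf M) (x + \<delta>) - tail (cdf M) (y + \<delta>) - c * (LBINT t=ereal x..ereal y. tail (cdf M) t)"
proof -
  have "(LBINT t=ereal x..ereal y. tail (cdf M) t) + (LBINT t=ereal y..\<infinity>. tail (cdf M) t)
      = (LBINT t=ereal x..\<infinity>. tail (cdf M) t)"
  proof (rule interval_integral_sum)
    have "min (ereal x) (min (ereal y) \<infinity>) = ereal (min x y)"
      and "max (ereal x) (max (ereal y) \<infinity>) = \<infinity>"
      by (auto simp: min_def max_def)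
    then show "interval_lebesgue_integrable lborel (min (ereal x) (min (ereal y) \<infinity>))
        (max (ereal x) (max (ereal y) \<infinity>)) (tail (cdf M))"
      using set_integrable_tail[OF assms, of "min x y"]
      by (simp only: interval_integrable_to_infinity_eq)
  qed
  from this[symmetric] show ?thesis
    by (simp add: H_fun_def ring_distribs)
qed

section \<open>Support, and vanishing of \<open>H\<close> almost everywhere\<close>

lemma AE_not_in_iff: "A \<in> sets borel \<Longrightarrow> (AE x in M. x \<notin> A) \<longleftrightarrow> prob A = 0"
  by (subst AE_iff_null_sets[symmetric]) (auto simp: null_sets_def emeasure_eq_measure)

text \<open>A point outside the support lies in an open interval of mass zero with rational endpoints,
  and there are only countably many of those.\<close>

lemma AE_in_supp: "AE x in M. x \<in> supp (cdf M)"
proof -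
  let ?N = "{(q, r). q \<in> \<rat> \<and> r \<in> \<rat> \<and> prob {q<..<r} = 0}"
  have "countable ?N"
    by (rule countable_subset[of _ "\<rat> \<times> \<rat>"]) (auto intro: countable_rat)
  moreover have "AE x in M. x \<notin> {fst p<..<snd p}" if "p \<in> ?N" for p
    using that by (subst AE_not_in_iff) auto
  ultimately have "AE x in M. \<forall>p\<in>?N. x \<notin> {fst p<..<snd p}"
    by (subst AE_ball_countable) (assumption, rule ballI, assumption)
  then show ?thesis
  proof eventually_elim
    case (elim x)
    show ?case unfolding supp_def
    proof safe
      fix \<epsilon> :: real assume "\<epsilon> > 0"
      obtain q where q: "q \<in> \<rat>" "x - \<epsilon> < q" "q < x"
        using Rats_dense_in_real[of "x - \<epsilon>" x] \<open>\<epsilon> > 0\<close> by auto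
      obtain r where r: "r \<in> \<rat>" "x < r" "r < x + \<epsilon>"
        using Rats_dense_in_real[of x "x + \<epsilon>"] \<open>\<epsilon> > 0\<close> by auto
      have "prob {q<..<r} \<noteq> 0" using elim q r by force
      then have "0 < prob {q<..<r}" by (simp add: less_le)
      also have "\<dots> \<le> prob {x - \<epsilon><..x + \<epsilon>}"
        using q r by (intro finite_measure_mono) auto
      also have "\<dots> = cdf M (x + \<epsilon>) - cdf M (x - \<epsilon>)"
        using \<open>\<epsilon> > 0\<close> by (subst cdf_diff_eq) auto
      finally show "0 < cdf M (x + \<epsilon>) - cdf M (x - \<epsilon>)" .
    qed
  qed
qed

lemma supp_meets_AE:
  assumes "AE y in M. P y" and "x \<in> supp (cdf M)" and "\<epsilon> > 0"
  obtains y where "P y" "x - \<epsilon> < y" "y \<le> x + \<epsilon>"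
proof -
  have "prob {x - \<epsilon><..x + \<epsilon>} > 0"
    using assms(2,3) cdf_diff_eq[of "x - \<epsilon>" "x + \<epsilon>"] by (auto simp: supp_def)
  moreover have "prob {x - \<epsilon><..x + \<epsilon>} = 0" if "\<And>y. x - \<epsilon> < y \<Longrightarrow> y \<le> x + \<epsilon> \<Longrightarrow> \<not> P y"
  proof -
    have "AE y in M. y \<notin> {x - \<epsilon><..x + \<epsilon>}"
      using assms(1) by eventually_elim (use that in auto)
    then show ?thesis
      by (subst (asm) AE_not_in_iff) auto
  qed
  ultimately show thesis using that by force
qed


text \<open>Points of \<open>R\<close> are not atoms, but their translates by \<open>\<delta>\<close> are.
  There are only countably many atoms, so \<open>R\<close> is a countable set of non-atoms, which is null.\<close>

lemma AE_in_T_set: "AE x in M. x \<in> T_set \<delta> (cdf M)"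
proof -
  note [simp] = mass_cdf[OF real_distribution_axioms]
  let ?A = "{x. prob {x} = 0 \<and> prob {x + \<delta>} > 0}"
  have "countable ?A"
  proof (rule countable_subset)
    show "?A \<subseteq> (\<lambda>z. z - \<delta>) ` {z. prob {z} > 0}" by (force intro: image_eqI)
  qed (intro countable_image countable_atoms)
  moreover have "AE x in M. x \<notin> {a}" if "a \<in> ?A" for a
    using that by (subst AE_not_in_iff) auto
  ultimately have "AE x in M. \<forall>a\<in>?A. x \<notin> {a}"
    by (subst AE_ball_countable) (assumption, rule ballI, assumption)
  with AE_in_supp show ?thesis
    by eventually_elim (auto simp: T_set_def R_set_def)
qed

lemma mass_S_set_iff:
  assumes "integrable M (\<lambda>y. y)"
  shows "mass (cdf M) (S_set c \<delta> (cdf M)) = 1 \<longleftrightarrow> (AE x in M. H_fun c \<delta> (cdf M) x = 0)"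
proof -
  have "S_set c \<delta> (cdf M) = {x\<in>space M. H_fun c \<delta> (cdf M) x = 0}"
    by (simp add: S_set_def)
  moreover have "{x\<in>space M. H_fun c \<delta> (cdf M) x = 0} \<in> events"
    using H_fun_measurable[OF assms] by simp
  ultimately show ?thesis
    by (simp add: mass_cdf[OF real_distribution_axioms] prob_Collect_eq_1 del: space_eq_univ)
qed

text \<open>One direction holds because almost every point lies in \<open>T\<close>.  For the other, let
  \<open>x \<in> T\<close>.  If \<open>x\<close> is an atom, an almost sure equation must hold at \<open>x\<close>.
  Otherwise \<open>x + \<delta>\<close> is not an atom, because \<open>x \<notin> R\<close>, so \<open>H\<close> is
  continuous at \<open>x\<close>; since \<open>x\<close> is in the support, it is a limit of zeros of
  \<open>H\<close>.\<close>

lemma AE_H_fun_zero_iff: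
  assumes "integrable M (\<lambda>y. y)"
  shows "(AE x in M. H_fun c \<delta> (cdf M) x = 0) \<longleftrightarrow> (\<forall>x\<in>T_set \<delta> (cdf M). H_fun c \<delta> (cdf M) x = 0)"
proof
  assume "\<forall>x\<in>T_set \<delta> (cdf M). H_fun c \<delta> (cdf M) x = 0"
  with AE_in_T_set[of \<delta>] show "AE x in M. H_fun c \<delta> (cdf M) x = 0" by auto
next
  note [simp] = mass_cdf[OF real_distribution_axioms]
  let ?H = "H_fun c \<delta> (cdf M)"
  assume AE: "AE x in M. ?H x = 0"
  show "\<forall>x\<in>T_set \<delta> (cdf M). ?H x = 0"
  proof
    fix x assume x: "x \<in> T_set \<delta> (cdf M)"
    show "?H x = 0"
    proof (cases "prob {x} = 0")
      case False
      show ?thesis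
      proof (rule ccontr)
        assume "?H x \<noteq> 0"
        from AE have "AE y in M. y \<notin> {x}"
        proof eventually_elim
          case (elim y)
          with \<open>?H x \<noteq> 0\<close> show ?case by (cases "y = x") simp_all
        qed
        with False show False by (subst (asm) AE_not_in_iff) auto
      qed
    next
      case True
      with x have supp: "x \<in> supp (cdf M)" and "prob {x + \<delta>} = 0"
        by (auto simp: T_set_def R_set_def less_le)
      then have cont: "isCont ?H x" by (intro isCont_H_fun assms)
      have "\<exists>y. ?H y = 0 \<and> x - 1 / Suc n < y \<and> y \<le> x + 1 / Suc n" for n
        using supp_meets_AE[OF AE supp, of "1 / Suc n"] by auto
      then obtain y where y: "\<And>n. ?H (y n) = 0"
          "\<And>n. x - 1 / Suc n < y n" "\<And>n. y n \<le> x + 1 / Suc n" by metis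
      have "y \<longlonglongrightarrow> x"
      proof (rule real_tendsto_sandwich[OF always_eventually always_eventually])
        show "(\<lambda>n. x - 1 / Suc n) \<longlonglongrightarrow> x"
          using tendsto_diff[OF tendsto_const LIMSEQ_inverse_real_of_nat, of x]
          by (simp add: inverse_eq_divide)
        show "(\<lambda>n. x + 1 / Suc n) \<longlonglongrightarrow> x"
          using tendsto_add[OF tendsto_const LIMSEQ_inverse_real_of_nat, of x]
          by (simp add: inverse_eq_divide)
      qed (rule allI less_imp_le[OF y(2)] y(3))+
      with cont have "(\<lambda>n. ?H (y n)) \<longlonglongrightarrow> ?H x"
        by (rule isCont_tendsto_compose)
      then show ?thesis by (simp add: y(1) LIMSEQ_const_iff)
    qed
  qed
qed

section \<open>When constancy of \<open>H\<close> on \<open>T\<close> forces it to vanish\<close>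

lemma T_set_unbounded:
  assumes "omega (cdf M) = \<infinity>"
  obtains x where "x \<in> T_set \<delta> (cdf M)" "x > a"
proof -
  have "ereal (a + 1) < omega (cdf M)" using assms by simp
  then obtain s where s: "s \<in> supp (cdf M)" "s > a + 1"
    unfolding omega_def less_Sup_iff by auto
  from supp_meets_AE[OF AE_in_T_set s(1), of 1] obtain x
    where "x \<in> T_set \<delta> (cdf M)" "s - 1 < x" by auto
  with s that show thesis by force
qed

text \<open>The constant is the limit of \<open>H\<close> at infinity along points of \<open>T\<close>.\<close>

lemma H_fun_zero_of_constant_on_unbounded:
  assumes "integrable M (\<lambda>y. y)" and "omega (cdf M) = \<infinity>"
    and const: "\<And>x y. x \<in> T_set \<delta> (cdf M) \<Longrightarrow> y \<in> T_set \<delta> (cdf M)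
      \<Longrightarrow> H_fun c \<delta> (cdf M) x = H_fun c \<delta> (cdf M) y"
    and x: "x \<in> T_set \<delta> (cdf M)"
  shows "H_fun c \<delta> (cdf M) x = 0"
proof -
  have "\<exists>z. z \<in> T_set \<delta> (cdf M) \<and> z > real n" for n
    using T_set_unbounded[OF assms(2)] by metis
  then obtain z where z: "\<And>n. z n \<in> T_set \<delta> (cdf M)" "\<And>n. z n > real n" by metis
  have "filterlim z at_top sequentially"
    using filterlim_real_sequentially
    by (rule filterlim_at_top_mono) (use z(2) in \<open>auto intro!: always_eventually less_imp_le\<close>)
  then have "(\<lambda>n. H_fun c \<delta> (cdf M) (z n)) \<longlonglongrightarrow> 0"
    by (rule filterlim_compose[OF H_fun_tendsto_0[OF assms(1)]])
  moreover have "H_fun c \<delta> (cdf M) (z n) = H_fun c \<delta> (cdf M) x" for n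
    by (rule const[OF z(1) x])
  ultimately have "(\<lambda>n::nat. H_fun c \<delta> (cdf M) x) \<longlonglongrightarrow> 0"
    by (simp only:)
  then show ?thesis
    by (simp only: LIMSEQ_const_iff)
qed

lemma supp_nonempty: "supp (cdf M) \<noteq> {}"
  using AE_in_supp AE_False by auto

text \<open>The support is closed and carries all the mass, so a finite right endpoint belongs to it and
  no mass lies beyond.\<close>

lemma finite_omega:
  assumes "omega (cdf M) \<noteq> \<infinity>"
  obtains w where "w \<in> supp (cdf M)" "prob {w<..} = 0"
proof -
  obtain s where s: "s \<in> supp (cdf M)" using supp_nonempty by auto
  then have "ereal s \<le> omega (cdf M)"
    unfolding omega_def by (intro Sup_upper) auto
  with assms obtain w where w: "omega (cdf M) = ereal w"
    by (cases "omega (cdf M)") auto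
  have upper: "y \<le> w" if "y \<in> supp (cdf M)" for y
    using Sup_upper[of "ereal y" "ereal ` supp (cdf M)"] that w by (auto simp: omega_def)
  have null: "prob {w<..} = 0"
  proof -
    have "AE y in M. y \<notin> {w<..}"
      using AE_in_supp by eventually_elim (use upper in force)
    then show ?thesis
      by (subst (asm) AE_not_in_iff) auto
  qed
  moreover have "w \<in> supp (cdf M)"
    unfolding supp_def
  proof safe
    fix \<epsilon> :: real assume "\<epsilon> > 0"
    then have "ereal (w - \<epsilon>) < omega (cdf M)" by (simp add: w)
    then obtain s where s: "s \<in> supp (cdf M)" "w - \<epsilon> < s"
      unfolding omega_def less_Sup_iff by auto
    \<comment> \<open>With this radius the interval around \<open>s\<close> starts exactly at \<open>w - \<epsilon>\<close>, so its mass is at most \<open>1 - F(w - \<epsilon>)\<close>.\<close>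
    define e where "e = s - (w - \<epsilon>)"
    have "e > 0" using s(2) by (simp add: e_def)
    then have "cdf M (s + e) - cdf M (s - e) > 0" using s(1) by (simp add: supp_def)
    moreover have "s - e = w - \<epsilon>" by (simp add: e_def)
    ultimately have "cdf M (w - \<epsilon>) < 1"
      using cdf_bounded_prob[of "s + e"] by simp
    moreover have "cdf M (w + \<epsilon>) = 1"
    proof -
      have "prob {w + \<epsilon><..} \<le> prob {w<..}"
        using \<open>\<epsilon> > 0\<close> by (intro finite_measure_mono) auto
      then have "tail (cdf M) (w + \<epsilon>) = 0"
        using null measure_nonneg[of M "{w + \<epsilon><..}"] unfolding tail_cdf by linarith
      then show ?thesis by (simp add: tail_def)
    qed
    ultimately show "0 < cdf M (w + \<epsilon>) - cdf M (w - \<epsilon>)"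
      by simp
  qed
  ultimately show thesis using that by blast
qed

text \<open>At the right endpoint \<open>w\<close> of the support both terms of \<open>H\<close> vanish.  For
  \<open>\<delta> > 0\<close> there is no atom at \<open>w + \<delta>\<close>, so \<open>w \<in> T\<close> and the
  constant value of \<open>H\<close> on \<open>T\<close> is \<open>0\<close>.\<close>

lemma H_fun_zero_of_constant_bounded:
  assumes "integrable M (\<lambda>y. y)" and "\<delta> > 0" and "omega (cdf M) \<noteq> \<infinity>"
    and const: "\<And>x y. x \<in> T_set \<delta> (cdf M) \<Longrightarrow> y \<in> T_set \<delta> (cdf M)
      \<Longrightarrow> H_fun c \<delta> (cdf M) x = H_fun c \<delta> (cdf M) y"
    and x: "x \<in> T_set \<delta> (cdf M)"
  shows "H_fun c \<delta> (cdf M) x = 0"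
proof -
  obtain w where w: "w \<in> supp (cdf M)" "prob {w<..} = 0"
    using finite_omega[OF assms(3)] by blast
  have null: "prob A = 0" if "A \<subseteq> {w<..}" for A
    using finite_measure_mono[OF that] w(2) measure_nonneg[of M A] by simp
  have "w \<in> T_set \<delta> (cdf M)"
    using w(1) null[of "{w + \<delta>}"] assms(2)
    by (auto simp: T_set_def R_set_def mass_cdf[OF real_distribution_axioms])
  moreover have "tail (cdf M) t = 0" if "t \<ge> w" for t
    using null[of "{t<..}"] that by (auto simp: tail_cdf)
  then have "H_fun c \<delta> (cdf M) w = 0"
    using assms(2)
    by (simp add: H_fun_def interval_integral_to_infinity_eq set_lebesgue_integral_def
        indicator_def cong: if_cong)
      (auto intro!: integral_eq_zero_AE)
  ultimately show ?thesis using const x by metis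
qed

end

section \<open>Conditional expectations and martingales in discrete time\<close>

lemma (in prob_space) subalgebra_sigma_finite:
  "subalgebra M \<F> \<Longrightarrow> sigma_finite_subalgebra M \<F>"
  by (intro finite_measure_subalgebra_is_sigma_finite)
    (simp add: finite_measure_subalgebra_def finite_measure_axioms finite_measure_subalgebra_axioms_def)

text \<open>The freezing lemma: given the \<open>\<sigma>\<close>-algebra generated by \<open>Y\<close>, the variable
  \<open>Y\<close> is a constant, and an independent \<open>W\<close> is averaged over its law.  A set of
  this \<open>\<sigma>\<close>-algebra has the form \<open>Y \<in> B\<close>, so the defining identity of
  the conditional expectation is Fubini's theorem for the product of the two laws.  Independence is
  stated through the joint law so that \<open>Y\<close> and \<open>W\<close> may take values in
  different types.\<close>

lemma (in prob_space) cond_exp_indep_freeze: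
  fixes f :: "'b \<times> 'c \<Rightarrow> real"
  assumes Y [measurable]: "Y \<in> M \<rightarrow>\<^sub>M S" and W [measurable]: "W \<in> M \<rightarrow>\<^sub>M T"
    and joint: "distr M (S \<Otimes>\<^sub>M T) (\<lambda>\<omega>. (Y \<omega>, W \<omega>)) = distr M S Y \<Otimes>\<^sub>M distr M T W"
    and \<F>: "sets \<F> = sets (vimage_algebra (space M) Y S)"
    and f [measurable]: "f \<in> borel_measurable (S \<Otimes>\<^sub>M T)"
    and int: "integrable M (\<lambda>\<omega>. f (Y \<omega>, W \<omega>))"
  shows "AE \<omega> in M. real_cond_exp M \<F> (\<lambda>\<omega>. f (Y \<omega>, W \<omega>)) \<omega> = (\<integral>w. f (Y \<omega>, w) \<partial>distr M T W)"
proof -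
  have YS: "Y \<in> space M \<rightarrow> space S" using Y by (rule measurable_space[THEN funcsetI])
  have YF: "Y \<in> \<F> \<rightarrow>\<^sub>M S"
    using measurable_vimage_algebra1[OF YS] by (simp cong: measurable_cong_sets add: \<F>)
  have space: "space \<F> = space M" using sets_eq_imp_space_eq[OF \<F>] by simp
  have sub: "subalgebra M \<F>"
    unfolding subalgebra_def using sets_image_in_sets[OF refl Y] by (simp add: space \<F>)
  interpret sigma_finite_subalgebra M \<F>
    using sub by (rule subalgebra_sigma_finite)
  let ?\<nu> = "distr M S Y" and ?\<tau> = "distr M T W"
  interpret \<nu>: prob_space ?\<nu> by (rule prob_space_distr) fact
  interpret \<tau>: prob_space ?\<tau> by (rule prob_space_distr) fact
  interpret P: pair_sigma_finite ?\<nu> ?\<tau> ..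
  define g where "g u = (\<integral>w. f (u, w) \<partial>?\<tau>)" for u
  have g [measurable]: "g \<in> borel_measurable S"
    unfolding g_def by measurable
  have intP: "integrable (?\<nu> \<Otimes>\<^sub>M ?\<tau>) f"
    unfolding joint[symmetric] using int by (subst integrable_distr_eq) auto
  have "AE \<omega> in M. real_cond_exp M \<F> (\<lambda>\<omega>. f (Y \<omega>, W \<omega>)) \<omega> = g (Y \<omega>)"
  proof (rule real_cond_exp_charact)
    have "integrable ?\<nu> g"
      using P.integrable_fst'[OF intP] by (simp add: g_def[abs_def])
    then show "integrable M (\<lambda>\<omega>. g (Y \<omega>))"
      by (subst (asm) integrable_distr_eq) auto
    show "(\<lambda>\<omega>. g (Y \<omega>)) \<in> borel_measurable \<F>"
      using YF g by (rule measurable_compose)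
  next
    fix A assume "A \<in> sets \<F>"
    then obtain B where [measurable]: "B \<in> sets S" and A: "A = Y -` B \<inter> space M"
      by (auto simp: \<F> sets_vimage_algebra2[OF YS])
    have ind: "indicator A \<omega> = (indicator B (Y \<omega>) :: real)" if "\<omega> \<in> space M" for \<omega>
      using that by (simp add: A indicator_def)
    have intB: "integrable (?\<nu> \<Otimes>\<^sub>M ?\<tau>) (\<lambda>p. indicator B (fst p) * f p)"
      using intP by (rule Bochner_Integration.integrable_bound) (auto simp: indicator_def)
    have "(\<integral>\<omega>\<in>A. f (Y \<omega>, W \<omega>) \<partial>M) = (\<integral>\<omega>. indicator B (Y \<omega>) * f (Y \<omega>, W \<omega>) \<partial>M)"
      unfolding set_lebesgue_integral_def by (intro Bochner_Integration.integral_cong) (auto simp: ind)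
    also have "\<dots> = (\<integral>p. indicator B (fst p) * f p \<partial>(?\<nu> \<Otimes>\<^sub>M ?\<tau>))"
      unfolding joint[symmetric] by (subst integral_distr) auto
    also have "\<dots> = (\<integral>u. (\<integral>w. indicator B u * f (u, w) \<partial>?\<tau>) \<partial>?\<nu>)"
      using P.integral_fst'[OF intB] by simp
    also have "\<dots> = (\<integral>u. indicator B u * g u \<partial>?\<nu>)"
      by (simp add: g_def)
    also have "\<dots> = (\<integral>\<omega>. indicator B (Y \<omega>) * g (Y \<omega>) \<partial>M)"
      by (subst integral_distr) auto
    also have "\<dots> = (\<integral>\<omega>\<in>A. g (Y \<omega>) \<partial>M)"
      unfolding set_lebesgue_integral_def by (intro Bochner_Integration.integral_cong) (auto simp: ind)
    finally show "(\<integral>\<omega>\<in>A. f (Y \<omega>, W \<omega>) \<partial>M) = (\<integral>\<omega>\<in>A. g (Y \<omega>) \<partial>M)" .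
  qed (rule int)
  then show ?thesis by (simp add: g_def)
qed

text \<open>The tower property reduces the identity for \<open>m \<le> n\<close> to single steps.\<close>

lemma martingale_iff_one_step:
  assumes "prob_space M"
    and sub: "\<And>n. n \<ge> 1 \<Longrightarrow> subalgebra M (\<F> n)"
    and mono: "\<And>m n. 1 \<le> m \<Longrightarrow> m \<le> n \<Longrightarrow> subalgebra (\<F> n) (\<F> m)"
    and adapted: "\<And>n. n \<ge> 1 \<Longrightarrow> Z n \<in> borel_measurable (\<F> n)"
    and int: "\<And>n. n \<ge> 1 \<Longrightarrow> integrable M (Z n)"
  shows "martingale M \<F> Z \<longleftrightarrow>
    (\<forall>n\<ge>1. AE \<omega> in M. real_cond_exp M (\<F> n) (Z (Suc n)) \<omega> = Z n \<omega>)"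
proof
  assume "martingale M \<F> Z"
  then show "\<forall>n\<ge>1. AE \<omega> in M. real_cond_exp M (\<F> n) (Z (Suc n)) \<omega> = Z n \<omega>"
    unfolding martingale_def by (metis le_SucI order_refl)
next
  interpret prob_space M by fact
  have sfs: "sigma_finite_subalgebra M (\<F> n)" if "n \<ge> 1" for n
    using sub[OF that] by (rule subalgebra_sigma_finite)
  assume step: "\<forall>n\<ge>1. AE \<omega> in M. real_cond_exp M (\<F> n) (Z (Suc n)) \<omega> = Z n \<omega>"
  have "AE \<omega> in M. real_cond_exp M (\<F> m) (Z n) \<omega> = Z m \<omega>" if "m \<ge> 1" "n \<ge> m" for m n
    using \<open>n \<ge> m\<close>
  proof (induction n rule: dec_induct)
    case base
    show ?case
      using sigma_finite_subalgebra.real_cond_exp_F_meas[OF sfs int adapted] that(1) by blast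
  next
    case (step n)
    interpret m: sigma_finite_subalgebra M "\<F> m" using sfs that(1) .
    have n: "n \<ge> 1" using step that by simp
    interpret n: sigma_finite_subalgebra M "\<F> n" using sfs n .
    have "AE \<omega> in M. real_cond_exp M (\<F> m) (real_cond_exp M (\<F> n) (Z (Suc n))) \<omega>
        = real_cond_exp M (\<F> m) (Z (Suc n)) \<omega>"
      using n step that by (intro m.real_cond_exp_nested_subalg sub mono int) auto
    moreover have "AE \<omega> in M. real_cond_exp M (\<F> m) (real_cond_exp M (\<F> n) (Z (Suc n))) \<omega>
        = real_cond_exp M (\<F> m) (Z n) \<omega>"
      using n \<open>\<forall>n\<ge>1. AE \<omega> in M. _ n \<omega>\<close> int[of n]
      by (intro m.real_cond_exp_cong) auto
    ultimately show ?case using step.IH by eventually_elim simp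
  qed
  then show "martingale M \<F> Z"
    unfolding martingale_def using sub mono adapted int by blast
qed

section \<open>The martingale property of an i.i.d. sequence\<close>

text \<open>The increment of \<open>N\<^sub>n - c M\<^sub>n\<close> when the current maximum is \<open>m\<close> and the
  next observation is \<open>x\<close>.\<close>

definition gain :: "real \<Rightarrow> real \<Rightarrow> real \<Rightarrow> real \<Rightarrow> real" where
  "gain c \<delta> m x = (if x > m + \<delta> then 1 else 0) - c * max 0 (x - m)"

locale iid_seq = prob_space M for M :: "'a measure" +
  fixes X :: "nat \<Rightarrow> 'a \<Rightarrow> real" and F :: "real \<Rightarrow> real"
  assumes iid: "iid_sample M X F"
begin

abbreviation law :: "real measure" where "law \<equiv> interval_measure F"

lemma indep_X: "indep_vars (\<lambda>_. borel) X {1..}"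
  and integrable_X: "n \<ge> 1 \<Longrightarrow> integrable M (X n)"
  using iid by (auto simp: iid_sample_def)

lemma X_measurable: "n \<ge> 1 \<Longrightarrow> X n \<in> borel_measurable M"
  using integrable_X by blast

lemma distr_X: "n \<ge> 1 \<Longrightarrow> distr M borel (X n) = law"
  using iid interval_measure_cdf[OF real_distribution_distr[OF X_measurable]]
  by (simp add: iid_sample_def)

sublocale law: real_distribution law
  using real_distribution_distr[OF X_measurable[of 1]] by (simp add: distr_X)

lemma cdf_law: "cdf law = F"
proof -
  have "cdf (distr M borel (X 1)) = F"
    using iid unfolding iid_sample_def by blast
  then show ?thesis by (simp add: distr_X)
qed

lemma integrable_law: "integrable law (\<lambda>y. y)"
  using integrable_X[of 1] X_measurable[of 1] by (simp add: integrable_distr_eq flip: distr_X[of 1])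

abbreviation hist :: "nat \<Rightarrow> 'a \<Rightarrow> nat \<Rightarrow> real" where
  "hist n \<omega> \<equiv> restrict (\<lambda>i. X i \<omega>) {1..n}"

abbreviation \<F> :: "nat \<Rightarrow> 'a measure" where "\<F> \<equiv> nat_filtration M X"

lemma space_filtration: "space (\<F> n) = space M"
  unfolding nat_filtration_def by (rule space_measure_of) auto

lemma sets_filtration: "sets (\<F> n) = sigma_sets (space M)
    (\<Union>i\<in>{1..n}. {X i -` A \<inter> space M | A. A \<in> sets borel})"
  unfolding nat_filtration_def by (rule sets_measure_of) auto

lemma X_adapted: "i \<in> {1..n} \<Longrightarrow> X i \<in> borel_measurable (\<F> n)"
  by (rule measurableI)
    (unfold sets_filtration space_filtration, simp, blast intro: sigma_sets.Basic)

text \<open>The freezing lemma needs the past to be generated by a single variable, namely the vector of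
  the first \<open>n\<close> observations.\<close>

lemma filtration_eq_vimage:
  "sets (\<F> n) = sets (vimage_algebra (space M) (hist n) (Pi\<^sub>M {1..n} (\<lambda>_. borel)))"
proof
  have "hist n \<in> \<F> n \<rightarrow>\<^sub>M Pi\<^sub>M {1..n} (\<lambda>_. borel)"
    by (intro measurable_restrict X_adapted)
  then show "sets (vimage_algebra (space M) (hist n) (Pi\<^sub>M {1..n} (\<lambda>_. borel))) \<subseteq> sets (\<F> n)"
    by (intro sets_image_in_sets space_filtration)
next
  let ?V = "vimage_algebra (space M) (hist n) (Pi\<^sub>M {1..n} (\<lambda>_. borel))"
  have "hist n \<in> ?V \<rightarrow>\<^sub>M Pi\<^sub>M {1..n} (\<lambda>_. borel)"
    by (rule measurable_vimage_algebra1) (auto simp: space_PiM)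
  then have X: "X i \<in> borel_measurable ?V" if "i \<in> {1..n}" for i
    using measurable_compose[OF _ measurable_component_singleton[OF that], of "hist n" ?V "\<lambda>_. borel"] that
    by simp
  have "X i -` A \<inter> space M \<in> sets ?V" if "i \<in> {1..n}" "A \<in> sets borel" for i A
    using measurable_sets[OF X[OF that(1)] that(2)] by simp
  then have "sigma_sets (space ?V) (\<Union>i\<in>{1..n}. {X i -` A \<inter> space M | A. A \<in> sets borel}) \<subseteq> sets ?V"
    by (intro sets.sigma_sets_subset) blast
  then show "sets (\<F> n) \<subseteq> sets ?V"
    by (simp add: sets_filtration)
qed

lemma subalgebra_filtration: "subalgebra M (\<F> n)"
  unfolding subalgebra_def sets_filtration space_filtration
  using X_measurable by (auto intro!: sets.sigma_sets_subset measurable_sets)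

lemma filtration_mono: "m \<le> n \<Longrightarrow> subalgebra (\<F> n) (\<F> m)"
  unfolding subalgebra_def sets_filtration space_filtration
  by (intro conjI refl sigma_sets_mono') force

lemma partial_max_Suc:
  "n \<ge> 1 \<Longrightarrow> partial_max X (Suc n) \<omega> = max (partial_max X n \<omega>) (X (Suc n) \<omega>)"
  by (simp add: partial_max_def atLeastAtMostSuc_conv max.commute)

lemma partial_max_adapted:
  "1 \<le> m \<Longrightarrow> m \<le> n \<Longrightarrow> partial_max X m \<in> borel_measurable (\<F> n)"
  unfolding partial_max_def[abs_def]
  by (intro borel_measurable_Max X_adapted) auto

lemma integrable_partial_max: "n \<ge> 1 \<Longrightarrow> integrable M (partial_max X n)"
proof (induction n rule: dec_induct)
  case base
  then show ?case using integrable_X[of 1] by (simp add: partial_max_def[abs_def])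
next
  case (step n)
  then have "integrable M (\<lambda>\<omega>. max (partial_max X n \<omega>) (X (Suc n) \<omega>))"
    by (intro integrable_max integrable_X) auto
  with step show ?case by (simp add: partial_max_Suc)
qed

lemma record_ind_adapted:
  assumes "1 \<le> k" "k \<le> n" shows "record_ind \<delta> X k \<in> borel_measurable (\<F> n)"
proof (cases "k = 1")
  case False
  with assms have [measurable]: "X k \<in> borel_measurable (\<F> n)" "partial_max X (k - 1) \<in> borel_measurable (\<F> n)"
    by (auto intro!: X_adapted partial_max_adapted)
  with False show ?thesis by (simp add: record_ind_def[abs_def])
qed (simp add: record_ind_def[abs_def])

lemma num_records_adapted: "num_records \<delta> X n \<in> borel_measurable (\<F> n)"
  unfolding num_records_def[abs_def]
  by (intro borel_measurable_sum record_ind_adapted) auto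

lemma integrable_num_records: "integrable M (num_records \<delta> X n)"
proof (rule integrable_const_bound[where B = n])
  show "AE \<omega> in M. norm (num_records \<delta> X n \<omega>) \<le> n"
  proof (rule AE_I2)
    fix \<omega>
    have "\<bar>num_records \<delta> X n \<omega>\<bar> \<le> (\<Sum>k=1..n. \<bar>record_ind \<delta> X k \<omega>\<bar>)"
      unfolding num_records_def by (rule sum_abs)
    also have "\<dots> \<le> (\<Sum>k=1..n. 1)"
      by (intro sum_mono) (simp add: record_ind_def)
    finally show "norm (num_records \<delta> X n \<omega>) \<le> n" by simp
  qed
qed (rule measurable_from_subalg[OF subalgebra_filtration num_records_adapted])

abbreviation Z :: "real \<Rightarrow> real \<Rightarrow> nat \<Rightarrow> 'a \<Rightarrow> real" where
  "Z c \<delta> n \<omega> \<equiv> num_records \<delta> X n \<omega> - c * partial_max X n \<omega>"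

lemma Z_adapted: "n \<ge> 1 \<Longrightarrow> Z c \<delta> n \<in> borel_measurable (\<F> n)"
  by (intro borel_measurable_diff borel_measurable_times borel_measurable_const
      num_records_adapted partial_max_adapted order_refl)

lemma Z_integrable: "n \<ge> 1 \<Longrightarrow> integrable M (Z c \<delta> n)"
  by (intro Bochner_Integration.integrable_diff integrable_mult_right integrable_num_records integrable_partial_max)

lemma Z_Suc: "n \<ge> 1 \<Longrightarrow> Z c \<delta> (Suc n) \<omega> = Z c \<delta> n \<omega> + gain c \<delta> (partial_max X n \<omega>) (X (Suc n) \<omega>)"
  by (simp add: num_records_def record_ind_def gain_def partial_max_Suc max_def algebra_simps)

text \<open>This identity is where \<open>H\<close> comes from: \<open>H m\<close> is the mean of the next increment
  when the current maximum is \<open>m\<close>.\<close>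

lemma gain_expectation: "(\<integral>x. gain c \<delta> m x \<partial>law) = H_fun c \<delta> F m"
proof -
  have "(\<integral>x. gain c \<delta> m x \<partial>law) = (\<integral>x. indicator {m + \<delta><..} x - c * max 0 (x - m) \<partial>law)"
    by (intro Bochner_Integration.integral_cong) (auto simp: gain_def)
  also have "\<dots> = law.prob {m + \<delta><..} - c * expected_excess law m"
    using law.integrable_excess[OF integrable_law]
    by (subst Bochner_Integration.integral_diff)
      (simp_all add: expected_excess_def integrable_real_indicator law.emeasure_eq_measure)
  finally show ?thesis
    using law.H_fun_cdf[OF integrable_law, of c \<delta> m] law.tail_cdf[of "m + \<delta>"]
    by (simp add: cdf_law)
qed

text \<open>The current maximum is a function of the past, and the next observation is independent of
  the past.\<close>

lemma cond_exp_gain: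
  assumes n: "n \<ge> 1"
  shows "AE \<omega> in M. real_cond_exp M (\<F> n)
    (\<lambda>\<omega>. gain c \<delta> (partial_max X n \<omega>) (X (Suc n) \<omega>)) \<omega> = H_fun c \<delta> F (partial_max X n \<omega>)"
proof -
  let ?S = "Pi\<^sub>M {1..n} (\<lambda>_. borel :: real measure)"
  let ?T = "Pi\<^sub>M {Suc n} (\<lambda>_. borel :: real measure)"
  let ?W = "\<lambda>\<omega>. restrict (\<lambda>i. X i \<omega>) {Suc n}"
  let ?f = "\<lambda>(u, v). gain c \<delta> (Max (u ` {1..n})) (v (Suc n))"
  have [measurable]: "(\<lambda>u. Max (u ` {1..n})) \<in> borel_measurable ?S"
    by (intro borel_measurable_Max) auto
  have eq: "?f (hist n \<omega>, ?W \<omega>) = gain c \<delta> (partial_max X n \<omega>) (X (Suc n) \<omega>)" for \<omega>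
    by (simp add: partial_max_def)
  \<comment> \<open>As a vector of length one the next observation has the type of the past, which \<open>indep_var\<close> demands.\<close>
  have "indep_var ?S (hist n) ?T ?W"
    by (rule indep_var_restrict[OF indep_X]) auto
  then have meas: "hist n \<in> M \<rightarrow>\<^sub>M ?S" "?W \<in> M \<rightarrow>\<^sub>M ?T"
    and joint: "distr M (?S \<Otimes>\<^sub>M ?T) (\<lambda>\<omega>. (hist n \<omega>, ?W \<omega>)) = distr M ?S (hist n) \<Otimes>\<^sub>M distr M ?T ?W"
    by (simp_all add: indep_var_distribution_eq)
  have "integrable M (\<lambda>\<omega>. Z c \<delta> (Suc n) \<omega> - Z c \<delta> n \<omega>)"
    using n by (intro Bochner_Integration.integrable_diff Z_integrable) auto
  then have "integrable M (\<lambda>\<omega>. ?f (hist n \<omega>, ?W \<omega>))"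
    unfolding eq using n by (simp add: Z_Suc)
  moreover have "?f \<in> borel_measurable (?S \<Otimes>\<^sub>M ?T)"
    unfolding gain_def by measurable
  ultimately have "AE \<omega> in M. real_cond_exp M (\<F> n) (\<lambda>\<omega>. ?f (hist n \<omega>, ?W \<omega>)) \<omega>
      = (\<integral>v. ?f (hist n \<omega>, v) \<partial>distr M ?T ?W)"
    by (intro cond_exp_indep_freeze[OF meas joint filtration_eq_vimage])
  moreover have "(\<integral>v. ?f (hist n \<omega>, v) \<partial>distr M ?T ?W) = H_fun c \<delta> F (partial_max X n \<omega>)" for \<omega>
  proof -
    have [measurable]: "gain c \<delta> m \<in> borel_measurable borel" for m
      unfolding gain_def[abs_def] by measurable
    have "(\<integral>v. ?f (hist n \<omega>, v) \<partial>distr M ?T ?W)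
        = (\<integral>\<omega>'. gain c \<delta> (partial_max X n \<omega>) (X (Suc n) \<omega>') \<partial>M)"
      by (subst integral_distr[OF meas(2)]) (simp_all add: partial_max_def)
    also have "\<dots> = (\<integral>x. gain c \<delta> (partial_max X n \<omega>) x \<partial>distr M borel (X (Suc n)))"
      using X_measurable[of "Suc n"] by (subst integral_distr) simp_all
    finally show ?thesis by (simp add: distr_X gain_expectation)
  qed
  ultimately show ?thesis unfolding eq by simp
qed

lemma cond_exp_Z_Suc:
  assumes n: "n \<ge> 1"
  shows "AE \<omega> in M. real_cond_exp M (\<F> n) (Z c \<delta> (Suc n)) \<omega>
    = Z c \<delta> n \<omega> + H_fun c \<delta> F (partial_max X n \<omega>)"
proof -
  interpret sigma_finite_subalgebra M "\<F> n"
    using subalgebra_filtration by (rule subalgebra_sigma_finite)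
  let ?g = "\<lambda>\<omega>. gain c \<delta> (partial_max X n \<omega>) (X (Suc n) \<omega>)"
  have "integrable M (\<lambda>\<omega>. Z c \<delta> (Suc n) \<omega> - Z c \<delta> n \<omega>)"
    using n by (intro Bochner_Integration.integrable_diff Z_integrable) auto
  then have g: "integrable M ?g" using n by (simp add: Z_Suc)
  have "AE \<omega> in M. real_cond_exp M (\<F> n) (\<lambda>\<omega>. Z c \<delta> n \<omega> + ?g \<omega>) \<omega>
      = real_cond_exp M (\<F> n) (Z c \<delta> n) \<omega> + real_cond_exp M (\<F> n) ?g \<omega>"
    using n by (intro real_cond_exp_add Z_integrable g)
  moreover have "AE \<omega> in M. real_cond_exp M (\<F> n) (Z c \<delta> n) \<omega> = Z c \<delta> n \<omega>"
    using n by (intro real_cond_exp_F_meas Z_integrable Z_adapted)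
  moreover note cond_exp_gain[OF n, of c \<delta>]
  moreover have "(\<lambda>\<omega>. Z c \<delta> n \<omega> + ?g \<omega>) = Z c \<delta> (Suc n)"
    using n by (simp add: Z_Suc fun_eq_iff)
  ultimately show ?thesis by auto
qed

lemma martingale_iff:
  "martingale M \<F> (Z c \<delta>) \<longleftrightarrow> (\<forall>n\<ge>1. AE \<omega> in M. H_fun c \<delta> F (partial_max X n \<omega>) = 0)"
proof -
  have "(AE \<omega> in M. real_cond_exp M (\<F> n) (Z c \<delta> (Suc n)) \<omega> = Z c \<delta> n \<omega>)
      \<longleftrightarrow> (AE \<omega> in M. H_fun c \<delta> F (partial_max X n \<omega>) = 0)" if "n \<ge> 1" for n
    by (rule eventually_subst, rule eventually_mono[OF cond_exp_Z_Suc[OF that, where c = c and \<delta> = \<delta>]]) auto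
  then show ?thesis
    by (subst martingale_iff_one_step)
      (auto intro: prob_space_axioms subalgebra_filtration filtration_mono Z_adapted Z_integrable)
qed

text \<open>For \<open>n = 1\<close> the maximum is \<open>X\<^sub>1\<close>, which has the common law.  Conversely, every maximum is
  one of the observations, and almost surely all observations are zeros of \<open>H\<close> at once.\<close>

lemma AE_H_fun_partial_max_iff:
  "(\<forall>n\<ge>1. AE \<omega> in M. H_fun c \<delta> F (partial_max X n \<omega>) = 0) \<longleftrightarrow> (AE x in law. H_fun c \<delta> F x = 0)"
proof -
  have [measurable]: "H_fun c \<delta> F \<in> borel_measurable borel"
    using law.H_fun_measurable[OF integrable_law, of c \<delta>] by (simp add: cdf_law)
  have X: "(AE \<omega> in M. H_fun c \<delta> F (X i \<omega>) = 0) \<longleftrightarrow> (AE x in law. H_fun c \<delta> F x = 0)" if "i \<ge> 1" for i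
    using X_measurable[OF that] by (subst distr_X[OF that, symmetric]) (simp add: AE_distr_iff)
  show ?thesis
  proof
    assume "\<forall>n\<ge>1. AE \<omega> in M. H_fun c \<delta> F (partial_max X n \<omega>) = 0"
    then have "AE \<omega> in M. H_fun c \<delta> F (partial_max X 1 \<omega>) = 0" by blast
    then show "AE x in law. H_fun c \<delta> F x = 0"
      using X[of 1] by (simp add: partial_max_def)
  next
    assume "AE x in law. H_fun c \<delta> F x = 0"
    then have "AE \<omega> in M. \<forall>i\<in>{1..}. H_fun c \<delta> F (X i \<omega>) = 0"
      using X by (subst AE_ball_countable) auto
    then have "AE \<omega> in M. H_fun c \<delta> F (partial_max X n \<omega>) = 0" if "n \<ge> 1" for n
    proof eventually_elim
      case (elim \<omega>)
      have "partial_max X n \<omega> \<in> (\<lambda>i. X i \<omega>) ` {1..n}"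
        unfolding partial_max_def using that by (intro Max_in) auto
      with elim show ?case by auto
    qed
    then show "\<forall>n\<ge>1. AE \<omega> in M. H_fun c \<delta> F (partial_max X n \<omega>) = 0"
      by blast
  qed
qed

lemma in_P_iff: "in_P M X c \<delta> F \<longleftrightarrow> (AE x in law. H_fun c \<delta> F x = 0)"
  unfolding in_P_def martingale_iff AE_H_fun_partial_max_iff using iid by blast

end

section \<open>The equivalences\<close>

theorem lemma1:
  fixes M :: "'a measure" and X :: "nat \<Rightarrow> 'a \<Rightarrow> real" and F :: "real \<Rightarrow> real"
    and c \<delta> :: real
  assumes "c > 0" and "\<delta> \<noteq> 0"
    and "iid_sample M X F"
  shows "let a = in_P M X c \<delta> F;
             b = (mass F (S_set c \<delta> F) = 1);
             c' = (\<forall>x \<in> T_set \<delta> F. H_fun c \<delta> F x = 0);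
             d = (\<forall>x \<in> T_set \<delta> F. \<forall>y \<in> T_set \<delta> F.
               tail F (x + \<delta>) - tail F (y + \<delta>) = c * (LBINT t=ereal x..ereal y. tail F t))
         in ((a \<longleftrightarrow> b) \<and> (b \<longleftrightarrow> c') \<and> (a \<longrightarrow> d) \<and> (b \<longrightarrow> d) \<and> (c' \<longrightarrow> d)) \<and>
            (\<delta> > 0 \<longrightarrow> d \<longrightarrow> c') \<and>
            (\<delta> < 0 \<and> omega F = \<infinity> \<longrightarrow> d \<longrightarrow> c')"
proof -
  interpret iid_seq M X F
    using assms(3) by (simp add: iid_seq_def iid_seq_axioms_def iid_sample_def)
  let ?c = "\<forall>x\<in>T_set \<delta> F. H_fun c \<delta> F x = 0"
  let ?d = "\<forall>x\<in>T_set \<delta> F. \<forall>y\<in>T_set \<delta> F.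
    tail F (x + \<delta>) - tail F (y + \<delta>) = c * (LBINT t=ereal x..ereal y. tail F t)"
  note int = integrable_law
  have ab: "in_P M X c \<delta> F \<longleftrightarrow> mass F (S_set c \<delta> F) = 1"
    using in_P_iff law.mass_S_set_iff[OF int, unfolded cdf_law] by simp
  have bc: "mass F (S_set c \<delta> F) = 1 \<longleftrightarrow> ?c"
    using law.mass_S_set_iff[OF int] law.AE_H_fun_zero_iff[OF int] by (simp add: cdf_law)
  have d_iff: "?d \<longleftrightarrow> (\<forall>x\<in>T_set \<delta> F. \<forall>y\<in>T_set \<delta> F. H_fun c \<delta> F x = H_fun c \<delta> F y)"
    using law.H_fun_diff[OF int, unfolded cdf_law] by (metis right_minus_eq)
  have cd: ?d if ?c
    unfolding d_iff using that by simp
  have dc_unbounded: ?c if ?d "omega F = \<infinity>"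
    using law.H_fun_zero_of_constant_on_unbounded[OF int, unfolded cdf_law] that
    unfolding d_iff by blast
  have dc_bounded: ?c if ?d "\<delta> > 0" "omega F \<noteq> \<infinity>"
    using law.H_fun_zero_of_constant_bounded[OF int, unfolded cdf_law] that
    unfolding d_iff by blast
  show ?thesis
    unfolding Let_def using ab bc cd dc_unbounded dc_bounded by blast
qed

end
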